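(* Let $n,m\in\mathbb{N}$, let $\alpha=\alpha_1\cdots\alpha_n$ and $\omega=\omega_1\cdots\omega_m$ be two finite words on $\{A,B\}$, and let $\phi:\{A,B\}^{\mathbb{Z}}\to\{A,B\}^{\mathbb{Z}}$ be the single marker endomorphism generated by $\alpha*\omega$. The following statements are equivalent: (1) $\phi$ is saturated; (2) $\phi$ is an involution (that is, $\phi\circ\phi=\mathrm{id}$); (3) $\phi$ is bijective.
   Context: $\mathbb{N}$ contains $0$; the words $\alpha$, $\omega$ may be empty. Write $\tilde A=B$, $\tilde B=A$. For a word $w=w_1\cdots w_k$, $w[a,b]$ denotes $w_a w_{a+1}\cdots w_b$; by convention $w[1,0]$ and $w[k+1,k]$ are the empty word. The empty word is a prefix and a suffix of every word. $\llbracket a,b\rrbracket$ denotes the set of integers from $a$ to $b$. Single marker endomorphism generated by $\alpha*\omega$: for $c=(c_k)_{k\in\mathbb{Z}}\in\{A,B\}^{\mathbb{Z}}$ and $l\in\mathbb{Z}$, $\phi(c)_l=\tilde{c_l}$ if $c_{l-n}\cdots c_{l-1}=\alpha$ and $c_{l+1}\cdots c_{l+m}=\omega$, and $\phi(c)_l=c_l$ otherwise (all swaps are performed simultaneously, according to the matches in $c$). Saturated: $\phi$ is saturated if both of the following hold. (i) For every $i\in\llbracket 1,n\rrbracket$, at least one of the following is true: for neither choice of $h\in\{A,B\}$ is $\omega$ a prefix of $\alpha[i+1,n]\,h\,\omega$; or $\alpha[1,i-1]$ is not a suffix of $\alpha$. (ii) For every $j\in\llbracket 1,m\rrbracket$,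 at least one of the following is true: for neither choice of $h\in\{A,B\}$ is $\alpha$ a suffix of $\alpha\,h\,\omega[1,j-1]$; or $\omega[j+1,m]$ is not a prefix of $\omega$. *)

theory Defs
  imports Main "HOL-Library.Sublist"
begin

datatype letter = A | B

fun swap_letter :: "letter \<Rightarrow> letter" where
  "swap_letter A = B"
| "swap_letter B = A"

text \<open>The factor \<open>w[a,b]\<close> with 1-based, inclusive indices.  It is only used with
  \<open>1 \<le> a \<le> b + 1 \<le> length w + 1\<close>; in particular \<open>w[1,0]\<close> and
  \<open>w[k+1,k]\<close> (\<open>k = length w\<close>) are the empty word.\<close>
definition factor :: "letter list \<Rightarrow> nat \<Rightarrow> nat \<Rightarrow> letter list" where
  "factor w a b = take (b + 1 - a) (drop (a - 1) w)"

definition marker_endo ::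
  "letter list \<Rightarrow> letter list \<Rightarrow> (int \<Rightarrow> letter) \<Rightarrow> (int \<Rightarrow> letter)" where
  "marker_endo \<alpha> \<omega> c = (\<lambda>l.
     if map c [l - int (length \<alpha>)..l - 1] = \<alpha> \<and> map c [l + 1..l + int (length \<omega>)] = \<omega>
     then swap_letter (c l) else c l)"

text \<open>Saturation is phrased, as in the mathematical definition, on the generating pattern
  \<open>\<alpha>*\<omega>\<close>.\<close>
definition saturated :: "letter list \<Rightarrow> letter list \<Rightarrow> bool" where
  "saturated \<alpha> \<omega> \<longleftrightarrow>
     (\<forall>i\<in>{1..length \<alpha>}.
        (\<forall>h. \<not> prefix \<omega> (factor \<alpha> (i + 1) (length \<alpha>) @ [h] @ \<omega>)) \<or>
        \<not> suffix (factor \<alpha> 1 (i - 1)) \<alpha>) \<and>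
     (\<forall>j\<in>{1..length \<omega>}.
        (\<forall>h. \<not> suffix \<alpha> (\<alpha> @ [h] @ factor \<omega> 1 (j - 1))) \<or>
        \<not> prefix (factor \<omega> (j + 1) (length \<omega>)) \<omega>)"

end

theory Submission imports Defs begin

text \<open>Say that the pattern \<open>\<alpha>*\<omega>\<close> occurs at \<open>l\<close> in \<open>c\<close> when the letters around position \<open>l\<close> spell
\<open>\<alpha>\<close> to the left and \<open>\<omega>\<close> to the right; \<open>marker_endo\<close> swaps exactly the letters at the
occurrences. Saturation is a condition on words, but it means that no configuration has two
occurrences of which one lies in the context read by the other
(\<open>saturated_iff_occurs_apart\<close>).

If occurrences are apart in this sense, a swap never touches the context of an occurrence, so
occurrences survive. None is created either: a new occurrence would need a swapped letter in its
context, hence an old, surviving occurrence there, and the image would contain two close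
occurrences. The image therefore has the same occurrences as the original, and the second
application undoes the first (\<open>involution_if_saturated\<close>).

Conversely, suppose that there are occurrences at \<open>0\<close> and at \<open>p > 0\<close>, one in the context of the
other. Reversing words and configurations, assume that the context in question is the left one,
that is, \<open>p \<le> length \<alpha>\<close>. The aim is a configuration \<open>x\<close> whose image \<open>y \<noteq> x\<close> contains no
occurrence at all: then \<open>x\<close> and \<open>y\<close> are both sent to \<open>y\<close>, and the map is not injective.
Comparing the two occurrences shows that \<open>\<alpha>\<close> and \<open>\<omega>\<close> have period \<open>p\<close>. Write \<open>v\<close> for the \<open>p - 1\<close>
letters between the positions \<open>0\<close> and \<open>p\<close>.

\<^item> If the letters at \<open>0\<close> and \<open>p\<close> agree, or if \<open>\<omega>\<close> is too short to see the letter at \<open>p\<close>, then the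
  pattern occurs in a \<open>p\<close>-periodic configuration, and this is \<open>x\<close>. Since \<open>\<alpha>\<close> contains a full
  period, an occurrence in a \<open>p\<close>-periodic configuration says that the configuration is a translate
  of \<open>x\<close>; but \<open>y\<close>, in which at least one letter per period of \<open>x\<close> was swapped from a fixed value
  to the other one, is no translate of \<open>x\<close> (\<open>not_inj_if_periodic_occurs\<close>).

\<^item> Otherwise \<open>\<alpha>\<close> is a suffix of \<open>\<dots>avav\<close> and \<open>\<omega>\<close> a prefix of \<open>vhvh\<dots>\<close> with \<open>a \<noteq> h\<close>. In a
  configuration in which copies of \<open>v\<close> alternate with arbitrary single letters, occurrences are
  possible only at the single letters, and there the map acts as the one generated by
  \<open>a\<^sup>s * h\<^sup>t\<close> with \<open>s, t \<ge> 1\<close>. For that map \<open>\<dots>hhh a\<^sup>s ah h\<^sup>t aaa\<dots>\<close> is sent to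
  \<open>\<dots>hhh a\<^sup>s ha h\<^sup>t aaa\<dots>\<close>, which has no occurrence (\<open>not_inj_if_periods_disagree\<close>).\<close>

section \<open>Occurrences of the pattern\<close>

text \<open>The left context is read outwards from the marked position, as is the right one. This makes the
two conjuncts mirror images of each other, and reflecting a configuration exchanges them.\<close>

definition occurs :: "letter list \<Rightarrow> letter list \<Rightarrow> (int \<Rightarrow> letter) \<Rightarrow> int \<Rightarrow> bool" where
  "occurs \<alpha> \<omega> c l \<longleftrightarrow>
     (\<forall>k<length \<alpha>. c (l - 1 - int k) = rev \<alpha> ! k) \<and>
     (\<forall>k<length \<omega>. c (l + 1 + int k) = \<omega> ! k)"

lemma occurs_iff_map:
  "occurs \<alpha> \<omega> c l \<longleftrightarrow>
     map c [l - int (length \<alpha>)..l - 1] = \<alpha> \<and> map c [l + 1..l + int (length \<omega>)] = \<omega>"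
proof -
  let ?n = "length \<alpha>"
  have "map c [l - int ?n..l - 1] = \<alpha> \<longleftrightarrow> (\<forall>i<?n. c (l - int ?n + int i) = \<alpha> ! i)"
    unfolding list_eq_iff_nth_eq by auto
  also have "\<dots> \<longleftrightarrow> (\<forall>k<?n. c (l - 1 - int k) = rev \<alpha> ! k)"
  proof (intro iffI allI impI)
    fix k assume H: "\<forall>i<?n. c (l - int ?n + int i) = \<alpha> ! i" and k: "k < ?n"
    have "l - int ?n + int (?n - Suc k) = l - 1 - int k" using k by (simp add: of_nat_diff)
    with H[rule_format, of "?n - Suc k"] k show "c (l - 1 - int k) = rev \<alpha> ! k"
      by (simp only: rev_nth)
  next
    fix i assume H: "\<forall>k<?n. c (l - 1 - int k) = rev \<alpha> ! k" and i: "i < ?n"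
    have "l - 1 - int (?n - Suc i) = l - int ?n + int i" using i by (simp add: of_nat_diff)
    moreover have "c (l - 1 - int (?n - Suc i)) = \<alpha> ! i"
      using H[rule_format, of "?n - Suc i"] i by (simp add: rev_nth)
    ultimately show "c (l - int ?n + int i) = \<alpha> ! i" by (simp only:)
  qed
  finally have L: "map c [l - int ?n..l - 1] = \<alpha> \<longleftrightarrow> (\<forall>k<?n. c (l - 1 - int k) = rev \<alpha> ! k)" .
  have R: "map c [l + 1..l + int (length \<omega>)] = \<omega> \<longleftrightarrow> (\<forall>k<length \<omega>. c (l + 1 + int k) = \<omega> ! k)"
    unfolding list_eq_iff_nth_eq by auto
  show ?thesis unfolding occurs_def L R ..
qed

lemma marker_endo_occurs:
  "marker_endo \<alpha> \<omega> c l = (if occurs \<alpha> \<omega> c l then swap_letter (c l) else c l)"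
  by (simp add: marker_endo_def occurs_iff_map)

lemma swap_letter_neq [simp]: "swap_letter x \<noteq> x" "x \<noteq> swap_letter x"
  by (cases x; simp)+

lemma swap_letter_swap_letter [simp]: "swap_letter (swap_letter x) = x"
  by (cases x; simp)

lemma swap_letter_iff_neq: "y = swap_letter x \<longleftrightarrow> y \<noteq> x"
  by (cases x; cases y; simp)

text \<open>Once one occurrence is known, the words can be forgotten: occurring elsewhere means having the
same letters around. All later arguments compare configurations in this way.\<close>

lemma occurs_transfer:
  assumes "occurs \<alpha> \<omega> c l"
  shows "occurs \<alpha> \<omega> d l' \<longleftrightarrow>
     (\<forall>k. 1 \<le> k \<and> k \<le> int (length \<alpha>) \<longrightarrow> d (l' - k) = c (l - k)) \<and>
     (\<forall>k. 1 \<le> k \<and> k \<le> int (length \<omega>) \<longrightarrow> d (l' + k) = c (l + k))"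
    (is "_ \<longleftrightarrow> ?L \<and> ?R")
proof -
  have L: "?L \<longleftrightarrow> (\<forall>k<length \<alpha>. d (l' - 1 - int k) = c (l - 1 - int k))"
  proof (intro iffI allI impI)
    fix k assume ?L "k < length \<alpha>"
    then show "d (l' - 1 - int k) = c (l - 1 - int k)"
      by (auto dest: spec[of _ "1 + int k"] simp: algebra_simps)
  next
    fix k assume H: "\<forall>k<length \<alpha>. d (l' - 1 - int k) = c (l - 1 - int k)"
      and k: "1 \<le> k \<and> k \<le> int (length \<alpha>)"
    with H[rule_format, of "nat (k - 1)"] show "d (l' - k) = c (l - k)"
      by (simp add: nat_less_iff)
  qed
  have R: "?R \<longleftrightarrow> (\<forall>k<length \<omega>. d (l' + 1 + int k) = c (l + 1 + int k))"
  proof (intro iffI allI impI)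
    fix k assume ?R "k < length \<omega>"
    then show "d (l' + 1 + int k) = c (l + 1 + int k)"
      by (auto dest: spec[of _ "1 + int k"] simp: algebra_simps)
  next
    fix k assume H: "\<forall>k<length \<omega>. d (l' + 1 + int k) = c (l + 1 + int k)"
      and k: "1 \<le> k \<and> k \<le> int (length \<omega>)"
    with H[rule_format, of "nat (k - 1)"] show "d (l' + k) = c (l + k)"
      by (simp add: nat_less_iff)
  qed
  show ?thesis
    unfolding L R using assms by (auto simp: occurs_def)
qed

lemma occurs_shift: "occurs \<alpha> \<omega> (\<lambda>i. c (i + s)) l \<longleftrightarrow> occurs \<alpha> \<omega> c (l + s)"
  by (simp add: occurs_def algebra_simps)

text \<open>Reflection exchanges the two halves of the pattern. It derives every statement about the right
context from the one about the left context.\<close>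

lemma occurs_reflect:
  "occurs (rev \<omega>) (rev \<alpha>) (\<lambda>i. c (- i)) l \<longleftrightarrow> occurs \<alpha> \<omega> c (- l)"
proof -
  have "- (l - 1 - k) = - l + 1 + k" "- (l + 1 + k) = - l - 1 - k" for k :: int
    by simp_all
  then show ?thesis unfolding occurs_def by (simp only: rev_rev_ident length_rev) blast
qed

lemma inj_marker_endo_reflect:
  assumes "inj (marker_endo \<alpha> \<omega>)"
  shows "inj (marker_endo (rev \<omega>) (rev \<alpha>))"
proof (rule injI)
  fix c d assume eq: "marker_endo (rev \<omega>) (rev \<alpha>) c = marker_endo (rev \<omega>) (rev \<alpha>) d"
  have refl: "marker_endo \<alpha> \<omega> (\<lambda>i. e (- i)) = (\<lambda>i. marker_endo (rev \<omega>) (rev \<alpha>) e (- i))" for e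
    using occurs_reflect[of "rev \<alpha>" "rev \<omega>" e] by (auto simp: marker_endo_occurs)
  have "(\<lambda>i. c (- i)) = (\<lambda>i. d (- i))"
    by (rule injD[OF assms]) (simp add: refl eq)
  then show "c = d" by (metis (full_types) ext minus_minus)
qed

section \<open>Saturation as a separation property\<close>

text \<open>The negation of the first saturation condition at \<open>i = length \<alpha> + 1 - p\<close>. The index is changed to
\<open>p\<close> because this is the distance between the two occurrences that the overlap describes.\<close>

definition left_overlap :: "letter list \<Rightarrow> letter list \<Rightarrow> nat \<Rightarrow> bool" where
  "left_overlap \<alpha> \<omega> p \<longleftrightarrow>
     (\<exists>h. prefix \<omega> (drop (length \<alpha> + 1 - p) \<alpha> @ [h] @ \<omega>)) \<and>
     suffix (take (length \<alpha> - p) \<alpha>) \<alpha>"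

text \<open>The second saturation condition is the first one for the reversed pattern. There \<open>j\<close> is already
the distance, so only the first condition has to be reindexed.\<close>

lemma saturated_iff_left_overlap:
  "saturated \<alpha> \<omega> \<longleftrightarrow>
     (\<forall>p\<in>{1..length \<alpha>}. \<not> left_overlap \<alpha> \<omega> p) \<and>
     (\<forall>p\<in>{1..length \<omega>}. \<not> left_overlap (rev \<omega>) (rev \<alpha>) p)"
proof -
  let ?P = "\<lambda>i. (\<forall>h. \<not> prefix \<omega> (factor \<alpha> (i + 1) (length \<alpha>) @ [h] @ \<omega>)) \<or>
        \<not> suffix (factor \<alpha> 1 (i - 1)) \<alpha>"
  let ?Q = "\<lambda>j. (\<forall>h. \<not> suffix \<alpha> (\<alpha> @ [h] @ factor \<omega> 1 (j - 1))) \<or>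
        \<not> prefix (factor \<omega> (j + 1) (length \<omega>)) \<omega>"
  have reidx: "(\<forall>i\<in>{1..n}. R i) \<longleftrightarrow> (\<forall>p\<in>{1..n}. R (n + 1 - p))" for R and n :: nat
  proof (intro iffI ballI)
    fix i assume H: "\<forall>p\<in>{1..n}. R (n + 1 - p)" and "i \<in> {1..n}"
    then have "n + 1 - i \<in> {1..n}" "n + 1 - (n + 1 - i) = i" by auto
    with H show "R i" by metis
  next
    fix p assume "\<forall>i\<in>{1..n}. R i" "p \<in> {1..n}"
    then show "R (n + 1 - p)" by (elim ballE[where x = "n + 1 - p"]) auto
  qed
  have P: "?P (length \<alpha> + 1 - p) \<longleftrightarrow> \<not> left_overlap \<alpha> \<omega> p" if "p \<in> {1..length \<alpha>}" for p
    using that by (simp add: left_overlap_def factor_def)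
  have Q: "?Q p \<longleftrightarrow> \<not> left_overlap (rev \<omega>) (rev \<alpha>) (p)" if "p \<in> {1..length \<omega>}" for p
    using that
    by (auto simp: left_overlap_def factor_def suffix_to_prefix rev_take rev_drop Suc_diff_le)
  have "(\<forall>i\<in>{1..length \<alpha>}. ?P i) \<longleftrightarrow> (\<forall>p\<in>{1..length \<alpha>}. \<not> left_overlap \<alpha> \<omega> p)"
    by (rule trans[OF reidx[where R = ?P]]) (intro ball_cong refl P)
  moreover have
    "(\<forall>j\<in>{1..length \<omega>}. ?Q j) \<longleftrightarrow> (\<forall>p\<in>{1..length \<omega>}. \<not> left_overlap (rev \<omega>) (rev \<alpha>) p)"
    by (intro ball_cong refl Q)
  ultimately show ?thesis by (simp only: saturated_def)
qed

lemma occurs_nth: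
  assumes "occurs \<alpha> \<omega> c l"
  shows "i < length \<alpha> \<Longrightarrow> \<alpha> ! i = c (l - int (length \<alpha>) + int i)"
    and "k < length \<omega> \<Longrightarrow> \<omega> ! k = c (l + 1 + int k)"
  using assms unfolding occurs_iff_map list_eq_iff_nth_eq by auto

lemma prefix_iff_nth:
  "prefix xs ys \<longleftrightarrow> length xs \<le> length ys \<and> (\<forall>k<length xs. ys ! k = xs ! k)"
proof
  assume "length xs \<le> length ys \<and> (\<forall>k<length xs. ys ! k = xs ! k)"
  then have "take (length xs) ys = xs" by (intro nth_equalityI) auto
  then show "prefix xs ys" by (metis take_is_prefix)
qed (auto simp: prefix_def nth_append)

lemma suffix_take_iff_nth:
  "suffix (take (length xs - p) xs) xs \<longleftrightarrow> (\<forall>i. i + p < length xs \<longrightarrow> xs ! (i + p) = xs ! i)"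
proof -
  have "suffix (take (length xs - p) xs) xs \<longleftrightarrow> drop p xs = take (length xs - p) xs"
  proof
    assume "suffix (take (length xs - p) xs) xs"
    then obtain zs where zs: "xs = zs @ take (length xs - p) xs" by (auto simp: suffix_def)
    show "drop p xs = take (length xs - p) xs"
    proof (cases "p \<le> length xs")
      case True
      then have "length zs = p" using arg_cong[OF zs, of length] by simp
      then show ?thesis using arg_cong[OF zs, of "drop p"] by simp
    qed simp
  next
    assume "drop p xs = take (length xs - p) xs"
    then show "suffix (take (length xs - p) xs) xs" by (metis suffix_drop)
  qed
  then show ?thesis
    by (auto simp: list_eq_iff_nth_eq add.commute)
qed

text \<open>The letters between \<open>l\<close> and \<open>l + p\<close> are the last \<open>p - 1\<close> letters of \<open>\<alpha>\<close>, seen from \<open>l + p\<close>; they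
are followed by an unknown letter \<open>h\<close> and by \<open>\<omega>\<close>. The occurrence at \<open>l\<close> reads \<open>\<omega>\<close> in this
sequence, and the two copies of \<open>\<alpha>\<close>, shifted by \<open>p\<close>, agree where they overlap.\<close>

lemma occurs_twice_imp_left_overlap:
  assumes occ: "occurs \<alpha> \<omega> c l" "occurs \<alpha> \<omega> c (l + int p)" and p: "p \<in> {1..length \<alpha>}"
  shows "left_overlap \<alpha> \<omega> p"
proof -
  let ?n = "length \<alpha>"
  have "(drop (?n + 1 - p) \<alpha> @ [c (l + int p)] @ \<omega>) ! k = \<omega> ! k" if k: "k < length \<omega>" for k
  proof -
    have *: "\<omega> ! k = c (l + 1 + int k)" using occurs_nth(2)[OF occ(1) k] .
    consider "Suc k < p" | "Suc k = p" | "p < Suc k" by linarith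
    then show ?thesis
    proof cases
      case 1
      then have "k < p - 1" "?n + 1 - p + k < ?n" using p by auto
      then show ?thesis
        using * p occurs_nth(1)[OF occ(2), of "?n + 1 - p + k"]
        by (simp add: nth_append of_nat_diff algebra_simps)
    next
      case 2
      then show ?thesis using * p by (auto simp: nth_append add.assoc)
    next
      case 3
      then show ?thesis
        using * p k occurs_nth(2)[OF occ(2), of "k - p"]
        by (auto simp: nth_append of_nat_diff algebra_simps)
    qed
  qed
  then have "prefix \<omega> (drop (?n + 1 - p) \<alpha> @ [c (l + int p)] @ \<omega>)"
    by (auto simp: prefix_iff_nth)
  moreover have "suffix (take (?n - p) \<alpha>) \<alpha>"
    unfolding suffix_take_iff_nth
    using occurs_nth(1)[OF occ(1)] occurs_nth(1)[OF occ(2)] by (simp add: algebra_simps)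
  ultimately show ?thesis by (auto simp: left_overlap_def)
qed

text \<open>The two conditions in \<open>left_overlap\<close> are just what is needed to superimpose the copy of the
pattern centred at \<open>0\<close> and the copy centred at \<open>p\<close> in a single configuration.\<close>

lemma left_overlap_imp_occurs_twice:
  assumes ov: "left_overlap \<alpha> \<omega> p" and p: "p \<in> {1..length \<alpha>}"
  obtains c where "occurs \<alpha> \<omega> c 0" "occurs \<alpha> \<omega> c (int p)"
proof -
  let ?n = "length \<alpha>"
  obtain h where pre: "\<And>k. k < length \<omega> \<Longrightarrow> (drop (?n + 1 - p) \<alpha> @ [h] @ \<omega>) ! k = \<omega> ! k"
    and suf: "\<And>i. i + p < ?n \<Longrightarrow> \<alpha> ! (i + p) = \<alpha> ! i"
    using ov by (auto simp: left_overlap_def prefix_iff_nth suffix_take_iff_nth)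
  \<comment> \<open>The copy at \<open>p\<close>, extended to the left by the part of the copy at \<open>0\<close> that it leaves free;
    the values beyond the two copies do not matter.\<close>
  define c where "c i =
     (if i < int p - int ?n then \<alpha> ! nat (i + int ?n)
      else if i < int p then \<alpha> ! nat (i + int ?n - int p)
      else if i = int p then h
      else \<omega> ! nat (i - int p - 1))" for i
  have "occurs \<alpha> \<omega> c (int p)"
    using p by (auto simp: occurs_def c_def rev_nth nat_diff_distrib' intro!: arg_cong[of _ _ "nth \<alpha>"])
  moreover have "occurs \<alpha> \<omega> c 0"
    unfolding occurs_def
  proof (intro conjI allI impI)
    fix k assume k: "k < ?n"
    show "c (0 - 1 - int k) = rev \<alpha> ! k"
    proof (cases "k + p < ?n")
      case True
      then have "c (0 - 1 - int k) = \<alpha> ! (?n - Suc k - p)"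
        by (auto simp: c_def intro!: arg_cong[of _ _ "nth \<alpha>"])
      also have "\<dots> = \<alpha> ! (?n - Suc k)" using suf[of "?n - Suc k - p"] True by simp
      finally show ?thesis using k by (simp add: rev_nth)
    next
      case False
      then show ?thesis using k
        by (auto simp: c_def rev_nth intro!: arg_cong[of _ _ "nth \<alpha>"])
    qed
  next
    fix k assume k: "k < length \<omega>"
    have "c (0 + 1 + int k) = (drop (?n + 1 - p) \<alpha> @ [h] @ \<omega>) ! k"
    proof -
      consider "Suc k < p" | "Suc k = p" | "p < Suc k" by linarith
      then show ?thesis
      proof cases
        case 1
        then have "nat (1 + int k + int ?n - int p) = ?n + 1 - p + k" using p by auto
        moreover have "k < p - 1" "1 + int k < int p" using 1 by simp_all
        ultimately show ?thesis using p by (simp add: nth_append c_def)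
      next
        case 2
        then show ?thesis using p by (auto simp: nth_append c_def)
      next
        case 3
        then have "nat (int k - int p) = k - p" by auto
        with 3 p show ?thesis by (auto simp: nth_append c_def)
      qed
    qed
    then show "c (0 + 1 + int k) = \<omega> ! k" using pre[OF k] by simp
  qed
  ultimately show thesis by (rule that[rotated])
qed

text \<open>The dynamical meaning of saturation: neither of two occurrences lies in the context of the other.\<close>

lemma saturated_iff_occurs_apart:
  "saturated \<alpha> \<omega> \<longleftrightarrow>
     (\<forall>c l p. occurs \<alpha> \<omega> c l \<longrightarrow> occurs \<alpha> \<omega> c (l + int p) \<longrightarrow> 0 < p \<longrightarrow>
        length \<alpha> < p \<and> length \<omega> < p)" (is "_ \<longleftrightarrow> ?apart")
proof
  assume sat: "saturated \<alpha> \<omega>"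
  show ?apart
  proof (intro allI impI)
    fix c l and p :: nat
    assume occ: "occurs \<alpha> \<omega> c l" "occurs \<alpha> \<omega> c (l + int p)" and p: "0 < p"
    have "\<not> p \<le> length \<alpha>"
      using sat occurs_twice_imp_left_overlap[OF occ] p by (auto simp: saturated_iff_left_overlap)
    moreover have "\<not> p \<le> length \<omega>"
      using sat occurs_twice_imp_left_overlap[of "rev \<omega>" "rev \<alpha>" "\<lambda>i. c (- i)" "- (l + int p)" p]
        occ p by (auto simp: saturated_iff_left_overlap occurs_reflect add.commute)
    ultimately show "length \<alpha> < p \<and> length \<omega> < p" by simp
  qed
next
  assume apart: ?apart
  have "\<not> left_overlap \<alpha> \<omega> p" if p: "p \<in> {1..length \<alpha>}" for p
  proof
    assume "left_overlap \<alpha> \<omega> p"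
    from left_overlap_imp_occurs_twice[OF this p] obtain c
      where "occurs \<alpha> \<omega> c 0" "occurs \<alpha> \<omega> c (int p)" .
    with apart[rule_format, of c 0 p] p show False by auto
  qed
  moreover have "\<not> left_overlap (rev \<omega>) (rev \<alpha>) p" if p: "p \<in> {1..length \<omega>}" for p
  proof
    assume "left_overlap (rev \<omega>) (rev \<alpha>) p"
    moreover have "p \<in> {1..length (rev \<omega>)}" using p by simp
    ultimately obtain c
      where "occurs (rev \<omega>) (rev \<alpha>) c 0" "occurs (rev \<omega>) (rev \<alpha>) c (int p)"
      by (rule left_overlap_imp_occurs_twice)
    then have "occurs \<alpha> \<omega> (\<lambda>i. c (- i)) (- int p)" "occurs \<alpha> \<omega> (\<lambda>i. c (- i)) (- int p + int p)"
      using occurs_reflect[of "rev \<alpha>" "rev \<omega>" c] by simp_all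
    with apart[rule_format, of "\<lambda>i. c (- i)" "- int p" p] p show False by auto
  qed
  ultimately show "saturated \<alpha> \<omega>" by (auto simp: saturated_iff_left_overlap)
qed

section \<open>Saturation implies involution\<close>

text \<open>Swapping leaves the context of every occurrence untouched, so occurrences persist. Conversely,
separation, applied in the image, keeps the persisting occurrences away from the context of an
occurrence in the image, so that context was not changed either.\<close>

lemma involution_if_saturated:
  assumes "saturated \<alpha> \<omega>"
  shows "marker_endo \<alpha> \<omega> \<circ> marker_endo \<alpha> \<omega> = id"
proof -
  let ?\<phi> = "marker_endo \<alpha> \<omega>" and ?n = "int (length \<alpha>)" and ?m = "int (length \<omega>)"
  have apartL: "\<not> occurs \<alpha> \<omega> c (l - k)"
    if "occurs \<alpha> \<omega> c l" "1 \<le> k" "k \<le> ?n \<or> k \<le> ?m" for c l k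
    using assms[unfolded saturated_iff_occurs_apart, rule_format, of c "l - k" "nat k"] that by auto
  have apartR: "\<not> occurs \<alpha> \<omega> c (l + k)"
    if "occurs \<alpha> \<omega> c l" "1 \<le> k" "k \<le> ?n \<or> k \<le> ?m" for c l k
    using assms[unfolded saturated_iff_occurs_apart, rule_format, of c l "nat k"] that by auto
  have keep: "occurs \<alpha> \<omega> (?\<phi> c) l" if "occurs \<alpha> \<omega> c l" for c l
    using apartL[OF that] apartR[OF that]
    unfolding occurs_transfer[OF that, of "?\<phi> c" l] by (auto simp: marker_endo_occurs)
  have "occurs \<alpha> \<omega> (?\<phi> c) l \<longleftrightarrow> occurs \<alpha> \<omega> c l" for c l
  proof
    assume occ: "occurs \<alpha> \<omega> (?\<phi> c) l"
    have "\<not> occurs \<alpha> \<omega> c (l - k)" "\<not> occurs \<alpha> \<omega> c (l + k)" if "1 \<le> k" "k \<le> ?n \<or> k \<le> ?m" for k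
      using keep apartL[OF occ that] apartR[OF occ that] by auto
    then show "occurs \<alpha> \<omega> c l"
      unfolding occurs_transfer[OF occ, of c l] by (auto simp: marker_endo_occurs)
  qed (rule keep)
  then show ?thesis by (auto simp: fun_eq_iff marker_endo_occurs)
qed

section \<open>Close occurrences in a periodic configuration\<close>

lemma periodic_imp_shift_multiple:
  fixes c :: "int \<Rightarrow> 'a"
  assumes "\<And>i. c (i + p) = c i"
  shows "c (i + p * q) = c i"
proof (induction q arbitrary: i rule: int_induct[where k = 0])
  case base
  then show ?case by simp
next
  case (step1 q)
  then show ?case using assms[of "i + p * q"] by (simp add: algebra_simps)
next
  case (step2 q)
  then show ?case using assms[of "i + p * (q - 1)"] by (simp add: algebra_simps)
qed

text \<open>As the left context covers a whole period, the pattern occurs in a \<open>p\<close>-periodic configuration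
exactly where that configuration is a translate of \<open>c\<close>. The image \<open>d\<close> of \<open>c\<close> is not such a
translate, so \<open>d\<close> is a fixed point different from its preimage \<open>c\<close>.\<close>

lemma not_inj_if_periodic_occurs:
  assumes occ: "occurs \<alpha> \<omega> c 0" and per: "\<And>i. c (i + p) = c i"
    and p: "0 < p" "p \<le> int (length \<alpha>)"
  shows "\<not> inj (marker_endo \<alpha> \<omega>)"
proof
  assume inj: "inj (marker_endo \<alpha> \<omega>)"
  define d where "d = marker_endo \<alpha> \<omega> c"
  have shift: "c (i + p * q) = c i" for i q
    using periodic_imp_shift_multiple[of c p, OF per] .
  have occ_iff: "occurs \<alpha> \<omega> e l \<longleftrightarrow> (\<forall>k. e (l + k) = c k)" if per_e: "\<And>i. e (i + p) = e i" for e l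
  proof
    assume "occurs \<alpha> \<omega> e l"
    then have near: "e (l - k) = c (- k)" if "1 \<le> k" "k \<le> p" for k
      using that p by (auto simp: occurs_transfer[OF occ])
    show "\<forall>k. e (l + k) = c k"
    proof
      fix k :: int
      define r where "r = k mod p"
      have k: "k = r + p * (k div p)" by (simp add: r_def)
      have r: "0 \<le> r" "r < p" using p by (auto simp: r_def)
      have "e (l + k) = e (l + r - p)"
        using periodic_imp_shift_multiple[of e p "l + r - p" "k div p + 1", OF per_e] k
        by (simp add: algebra_simps)
      also have "\<dots> = c (r - p)" using near[of "p - r"] r by (simp add: algebra_simps)
      also have "\<dots> = c k" using shift[of "r - p" "k div p + 1"] k by (simp add: algebra_simps)
      finally show "e (l + k) = c k" .
    qed
  next
    assume "\<forall>k. e (l + k) = c k"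
    then show "occurs \<alpha> \<omega> e l" by (simp add: occurs_transfer[OF occ] diff_conv_add_uminus del: add_uminus_conv_diff)
  qed
  have d: "d l = (if \<forall>k. c (l + k) = c k then swap_letter (c l) else c l)" for l
    unfolding d_def marker_endo_occurs using occ_iff[of c l, OF per] by simp
  have per_d: "d (i + p) = d i" for i
  proof -
    have "c (i + p + k) = c (i + k)" for k using per[of "i + k"] by (simp add: algebra_simps)
    then show ?thesis by (simp add: d per)
  qed
  have "\<not> occurs \<alpha> \<omega> d l" for l
  proof
    assume "occurs \<alpha> \<omega> d l"
    then have dl: "d (l + k) = c k" for k using occ_iff[of d l, OF per_d] by simp
    \<comment> \<open>If \<open>d\<close> were \<open>c\<close> translated by \<open>l\<close>, the letter at \<open>0\<close> would propagate along the multiples of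
      \<open>l\<close>: each of these is either a translation period of \<open>c\<close>, or a position where \<open>c\<close> and \<open>d\<close>
      agree. After \<open>p\<close> steps this reaches a period of \<open>c\<close>, where \<open>d\<close> has the other letter.\<close>
    have c0: "c (int t * l) = c 0" for t
    proof (induction t)
      case (Suc t)
      show ?case
      proof (cases "\<forall>k. c (int (Suc t) * l + k) = c k")
        case True
        then show ?thesis by (metis add.right_neutral)
      next
        case False
        then have "c (int (Suc t) * l) = d (int (Suc t) * l)" by (simp add: d)
        also have "\<dots> = c (int t * l)" using dl[of "int t * l"] by (simp add: algebra_simps)
        finally show ?thesis using Suc by simp
      qed
    qed simp
    have mult: "c (p * l + k) = c k" for k using shift[of k l] by (simp add: algebra_simps)
    have "d (p * l) \<noteq> c 0" using mult mult[of 0] by (simp add: d)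
    moreover have "d (p * l) = c ((p - 1) * l)" using dl[of "(p - 1) * l"] by (simp add: algebra_simps)
    moreover have "c ((p - 1) * l) = c 0" using c0[of "nat (p - 1)"] p by simp
    ultimately show False by simp
  qed
  then have "marker_endo \<alpha> \<omega> d = d" by (auto simp: fun_eq_iff marker_endo_occurs)
  also have "d = marker_endo \<alpha> \<omega> c" by (fact d_def)
  finally have "d = c" by (rule injD[OF inj])
  moreover have "d 0 \<noteq> c 0" by (simp add: d)
  ultimately show False by simp
qed

section \<open>Close occurrences with different marked letters\<close>

lemma left_period_imp_eq_mod:
  fixes c :: "int \<Rightarrow> 'a"
  assumes per: "\<And>k. 1 \<le> k \<Longrightarrow> k \<le> n \<Longrightarrow> c (p - k) = c (- k)"
    and p: "0 < p" and i: "- n \<le> i" "i < p"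
  shows "c i = c (i mod p)"
  using i
proof (induction "nat (p - i)" arbitrary: i rule: less_induct)
  case less
  show ?case
  proof (cases "0 \<le> i")
    case True
    then show ?thesis using less.prems by simp
  next
    case False
    then have "c i = c (i + p)" using per[of "- i"] less.prems by (simp add: add.commute)
    also have "\<dots> = c ((i + p) mod p)" using False less.prems p by (intro less.hyps) auto
    finally show ?thesis by simp
  qed
qed

text \<open>On this side the periodicity starts only at \<open>1\<close>, so the letter repeated at the multiples of \<open>p\<close> is
that at \<open>p\<close>, which may differ from that at \<open>0\<close>.\<close>

lemma right_period_imp_eq_mod:
  fixes c :: "int \<Rightarrow> 'a"
  assumes per: "\<And>k. 1 \<le> k \<Longrightarrow> k \<le> m \<Longrightarrow> c (p + k) = c k"
    and p: "0 < p" and i: "1 \<le> i" "i \<le> m + p"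
  shows "c i = (if p dvd i then c p else c (i mod p))"
  using i
proof (induction "nat i" arbitrary: i rule: less_induct)
  case less
  consider "i < p" | "i = p" | "p < i" by linarith
  then show ?case
  proof cases
    case 1
    then show ?thesis using less.prems by (auto dest: zdvd_imp_le)
  next
    case 3
    then have "c i = c (i - p)" using per[of "i - p"] less.prems by simp
    also have "\<dots> = (if p dvd i - p then c p else c ((i - p) mod p))"
      using 3 less.prems p by (intro less.hyps) auto
    finally show ?thesis by (simp add: dvd_eq_mod_eq_0)
  qed simp
qed

lemma le_zdiv_iff:
  fixes i n p :: int
  assumes "0 < p"
  shows "i \<le> n div p \<longleftrightarrow> p * i \<le> n"
proof
  assume "i \<le> n div p"
  then have "p * i \<le> p * (n div p)" using assms by simp
  also have "\<dots> \<le> n" using assms by (simp add: minus_mod_eq_mult_div [symmetric])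
  finally show "p * i \<le> n" .
next
  assume "p * i \<le> n"
  then show "i \<le> n div p" using zdiv_mono1[of "p * i" n p] assms by simp
qed

text \<open>Here the left context repeats the letter at \<open>0\<close> at all multiples of \<open>p\<close>, whereas the right context
repeats the other letter, that at \<open>p\<close>. The configurations \<open>D x\<close> below carry an arbitrary sequence
\<open>x\<close> on the multiples of \<open>p\<close> and the letters common to both contexts elsewhere; on \<open>x\<close> the map acts
like the marker endomorphism of a power of one letter followed by a power of the other.\<close>

lemma not_inj_if_periods_disagree:
  assumes occ: "occurs \<alpha> \<omega> c 0"
    and perL: "\<And>k. 1 \<le> k \<Longrightarrow> k \<le> int (length \<alpha>) \<Longrightarrow> c (p - k) = c (- k)"
    and perR: "\<And>k. 1 \<le> k \<Longrightarrow> k \<le> int (length \<omega>) \<Longrightarrow> c (p + k) = c k"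
    and p: "0 < p" "p \<le> int (length \<alpha>)" "p \<le> int (length \<omega>)"
    and neq: "c 0 \<noteq> c p"
  shows "\<not> inj (marker_endo \<alpha> \<omega>)"
proof
  assume inj: "inj (marker_endo \<alpha> \<omega>)"
  \<comment> \<open>The numbers of multiples of \<open>p\<close> that the left and the right context see from a multiple.\<close>
  define s where "s = int (length \<alpha>) div p"
  define t where "t = int (length \<omega>) div p"
  define D where "D x i = (if p dvd i then x (i div p) else c (i mod p))" for x i
  have le_s: "i \<le> s \<longleftrightarrow> p * i \<le> int (length \<alpha>)" and le_t: "i \<le> t \<longleftrightarrow> p * i \<le> int (length \<omega>)" for i
    using p(1) by (simp_all add: s_def t_def le_zdiv_iff)
  have st: "1 \<le> s" "1 \<le> t" using p le_s[of 1] le_t[of 1] by simp_all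
  have cL: "c (- k) = c ((- k) mod p)" if "1 \<le> k" "k \<le> int (length \<alpha>)" for k
    using left_period_imp_eq_mod[of "int (length \<alpha>)" c p "- k"] perL p that by simp
  have cR: "c k = (if p dvd k then c p else c (k mod p))" if "1 \<le> k" "k \<le> int (length \<omega>)" for k
    using right_period_imp_eq_mod[of "int (length \<omega>)" c p k] perR p that by simp
  have occ_dvd: "p dvd l" if "occurs \<alpha> \<omega> (D x) l" for x l
  proof (rule ccontr)
    \<comment> \<open>Away from the multiples of \<open>p\<close> the configuration is periodic, but the two contexts demand
      different letters at distance \<open>p\<close> on either side.\<close>
    assume "\<not> p dvd l"
    then have "D x (l - p) = D x (l + p)" by (simp add: D_def dvd_eq_mod_eq_0)
    moreover have "D x (l - p) = c (- p)" "D x (l + p) = c p"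
      using that p by (auto simp: occurs_transfer[OF occ])
    moreover have "c (- p) = c 0" using perL[of p] p by simp
    ultimately show False using neq by simp
  qed
  have occ_iff: "occurs \<alpha> \<omega> (D x) (p * j) \<longleftrightarrow>
      (\<forall>i. 1 \<le> i \<and> i \<le> s \<longrightarrow> x (j - i) = c 0) \<and> (\<forall>i. 1 \<le> i \<and> i \<le> t \<longrightarrow> x (j + i) = c p)" for x j
  proof -
    have pos: "1 \<le> p * i \<longleftrightarrow> 1 \<le> i" for i
      using p(1) zero_less_mult_iff[of p i] by (smt (verit))
    have DL: "D x (p * j - p * i) = x (j - i)" and DR: "D x (p * j + p * i) = x (j + i)" for i
      using p(1) by (simp_all add: D_def flip: right_diff_distrib distrib_left)
    have L: "(\<forall>k. 1 \<le> k \<and> k \<le> int (length \<alpha>) \<longrightarrow> D x (p * j - k) = c (0 - k)) \<longleftrightarrow>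
        (\<forall>i. 1 \<le> i \<and> i \<le> s \<longrightarrow> x (j - i) = c 0)" (is "?l \<longleftrightarrow> ?r")
    proof (intro iffI allI impI)
      fix i assume ?l "1 \<le> i \<and> i \<le> s"
      then show "x (j - i) = c 0"
        using cL[of "p * i"] DL[of i] by (simp add: le_s pos)
    next
      fix k assume r: ?r and k: "1 \<le> k \<and> k \<le> int (length \<alpha>)"
      show "D x (p * j - k) = c (0 - k)"
      proof (cases "p dvd k")
        case True
        then obtain i where "k = p * i" ..
        then show ?thesis using r k cL[of "p * i"] DL[of i] by (simp add: le_s pos)
      next
        case False
        then have "\<not> p dvd p * j - k" by (simp add: dvd_diff_right_iff)
        moreover have "(p * j - k) mod p = (- k) mod p"
          by (metis diff_conv_add_uminus mod_mult_self4)
        ultimately show ?thesis using cL[of k] k by (simp add: D_def)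
      qed
    qed
    have R: "(\<forall>k. 1 \<le> k \<and> k \<le> int (length \<omega>) \<longrightarrow> D x (p * j + k) = c (0 + k)) \<longleftrightarrow>
        (\<forall>i. 1 \<le> i \<and> i \<le> t \<longrightarrow> x (j + i) = c p)" (is "?l \<longleftrightarrow> ?r")
    proof (intro iffI allI impI)
      fix i assume ?l "1 \<le> i \<and> i \<le> t"
      then show "x (j + i) = c p"
        using cR[of "p * i"] DR[of i] by (simp add: le_t pos)
    next
      fix k assume r: ?r and k: "1 \<le> k \<and> k \<le> int (length \<omega>)"
      show "D x (p * j + k) = c (0 + k)"
      proof (cases "p dvd k")
        case True
        then obtain i where "k = p * i" ..
        then show ?thesis using r k cR[of "p * i"] DR[of i] by (simp add: le_t pos)
      next
        case False
        then show ?thesis using cR[of k] k by (simp add: D_def dvd_add_right_iff)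
      qed
    qed
    show ?thesis unfolding occurs_transfer[OF occ] L R ..
  qed
  \<comment> \<open>With \<open>a = c 0\<close> and \<open>h = c p\<close>, the sequence \<open>x\<close> is \<open>\<dots>hhh a\<^sup>s ah h\<^sup>t aaa\<dots>\<close>, and \<open>y\<close> is \<open>x\<close>
    with the two middle letters, those at \<open>s\<close> and \<open>s + 1\<close>, swapped. An occurrence needs at least \<open>s\<close>
    letters \<open>a\<close> in a row, followed by at least \<open>t\<close> letters \<open>h\<close>, and one more letter in one of the two
    runs. The outer blocks limit the inner runs of \<open>y\<close>, so that \<open>a\<close>-runs and \<open>h\<close>-runs of these
    lengths never follow each other.\<close>
  define x where "x j = (if 0 \<le> j \<and> j \<le> s \<or> s + t + 2 \<le> j then c 0 else c p)" for j
  define y where "y j = (if 0 \<le> j \<and> j < s \<or> j = s + 1 \<or> s + t + 2 \<le> j then c 0 else c p)" for j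
  have occ_x: "occurs \<alpha> \<omega> (D x) (p * j) \<longleftrightarrow> j = s \<or> j = s + 1" for j
  proof
    assume "occurs \<alpha> \<omega> (D x) (p * j)"
    then have "x (j - 1) = c 0" "x (j + 1) = c p" using st by (simp_all add: occ_iff)
    then show "j = s \<or> j = s + 1" using neq st by (auto simp: x_def split: if_splits)
  next
    assume "j = s \<or> j = s + 1"
    then show "occurs \<alpha> \<omega> (D x) (p * j)" using st by (auto simp: occ_iff x_def)
  qed
  have occ_y: "\<not> occurs \<alpha> \<omega> (D y) (p * j)" for j
  proof
    assume "occurs \<alpha> \<omega> (D y) (p * j)"
    then have "y (j - 1) = c 0" "y (j + 1) = c p" "y (j - s) = c 0" "y (j + t) = c p"
      using st by (simp_all add: occ_iff)
    then show False using neq st by (auto simp: y_def split: if_splits)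
  qed
  have "marker_endo \<alpha> \<omega> (D x) = D y"
  proof
    fix l
    show "marker_endo \<alpha> \<omega> (D x) l = D y l"
    proof (cases "p dvd l")
      case True
      then obtain j where l: "l = p * j" ..
      have "D x l = x j" "D y l = y j" using l p by (simp_all add: D_def)
      then show ?thesis
        using occ_x[of j] neq st l
        by (auto simp: marker_endo_occurs x_def y_def swap_letter_iff_neq eq_commute[of "swap_letter _"])
    next
      case False
      then show ?thesis using occ_dvd[of x l] by (auto simp: marker_endo_occurs D_def)
    qed
  qed
  also have "D y = marker_endo \<alpha> \<omega> (D y)"
    using occ_dvd[of y] occ_y by (auto simp: fun_eq_iff marker_endo_occurs elim!: dvdE)
  finally have "D x = D y" by (rule injD[OF inj])
  then have "D x (p * s) = D y (p * s)" by simp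
  then show False using p neq st by (simp add: D_def x_def y_def)
qed

section \<open>Injectivity implies saturation\<close>

text \<open>Comparing the two occurrences gives period \<open>p\<close> on both sides of \<open>0\<close>. The letters at \<open>0\<close> and \<open>p\<close>
decide whether the two periodic pieces fit together into one periodic configuration.\<close>

lemma not_inj_if_occurs_within_left_context:
  assumes occ: "occurs \<alpha> \<omega> c 0" "occurs \<alpha> \<omega> c p" and p: "0 < p" "p \<le> int (length \<alpha>)"
  shows "\<not> inj (marker_endo \<alpha> \<omega>)"
proof -
  have perL: "c (p - k) = c (- k)" if "1 \<le> k" "k \<le> int (length \<alpha>)" for k
    using occ(2) that by (simp add: occurs_transfer[OF occ(1)])
  have perR: "c (p + k) = c k" if "1 \<le> k" "k \<le> int (length \<omega>)" for k
    using occ(2) that by (simp add: occurs_transfer[OF occ(1)])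
  show ?thesis
  proof (cases "p \<le> int (length \<omega>) \<and> c 0 \<noteq> c p")
    case True
    then show ?thesis using not_inj_if_periods_disagree[of \<alpha> \<omega> c p, OF occ(1) perL perR p] by simp
  next
    case False
    define d where "d i = c (i mod p)" for i
    have "d (- k) = c (- k)" if "1 \<le> k" "k \<le> int (length \<alpha>)" for k
      using left_period_imp_eq_mod[of "int (length \<alpha>)" c p "- k"] perL p that by (simp add: d_def)
    moreover have "d k = c k" if k: "1 \<le> k" "k \<le> int (length \<omega>)" for k
    proof (cases "p \<le> int (length \<omega>)")
      case True
      then show ?thesis
        using right_period_imp_eq_mod[of "int (length \<omega>)" c p k] perR p k False
        by (auto simp: d_def dvd_eq_mod_eq_0)
    qed (use k in \<open>simp add: d_def\<close>)
    ultimately have "occurs \<alpha> \<omega> d 0" by (simp add: occurs_transfer[OF occ(1)])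
    then show ?thesis by (rule not_inj_if_periodic_occurs) (use p in \<open>simp_all add: d_def\<close>)
  qed
qed

lemma saturated_if_inj:
  assumes inj: "inj (marker_endo \<alpha> \<omega>)"
  shows "saturated \<alpha> \<omega>"
  unfolding saturated_iff_occurs_apart
proof (intro allI impI)
  fix c l and p :: nat
  assume occ: "occurs \<alpha> \<omega> c l" "occurs \<alpha> \<omega> c (l + int p)" and p: "0 < p"
  have "\<not> p \<le> length \<alpha>"
    using not_inj_if_occurs_within_left_context[of \<alpha> \<omega> "\<lambda>i. c (i + l)" "int p"] occ p inj
    by (auto simp: occurs_shift add.commute)
  moreover have "\<not> p \<le> length \<omega>"
  proof
    assume "p \<le> length \<omega>"
    define d where "d i = c (i + (l + int p))" for i
    have "occurs \<alpha> \<omega> d 0" "occurs \<alpha> \<omega> d (- int p)"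
      using occ occurs_shift[of \<alpha> \<omega> c "l + int p"] by (simp_all add: d_def[abs_def])
    then have "occurs (rev \<omega>) (rev \<alpha>) (\<lambda>i. d (- i)) 0" "occurs (rev \<omega>) (rev \<alpha>) (\<lambda>i. d (- i)) (int p)"
      by (simp_all add: occurs_reflect)
    then have "\<not> inj (marker_endo (rev \<omega>) (rev \<alpha>))"
      by (rule not_inj_if_occurs_within_left_context) (use p \<open>p \<le> length \<omega>\<close> in simp_all)
    with inj_marker_endo_reflect[OF inj] show False by simp
  qed
  ultimately show "length \<alpha> < p \<and> length \<omega> < p" by simp
qed

theorem theorem3p3:
  fixes \<alpha> \<omega> :: "letter list" and \<phi> :: "(int \<Rightarrow> letter) \<Rightarrow> (int \<Rightarrow> letter)"
  assumes "\<phi> = marker_endo \<alpha> \<omega>"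
  shows "(saturated \<alpha> \<omega> \<longleftrightarrow> \<phi> \<circ> \<phi> = id) \<and> (\<phi> \<circ> \<phi> = id \<longleftrightarrow> bij \<phi>)"
proof -
  have "\<phi> \<circ> \<phi> = id" if "saturated \<alpha> \<omega>"
    using involution_if_saturated[OF that] assms by simp
  moreover have "bij \<phi>" if "\<phi> \<circ> \<phi> = id"
    using that o_bij by blast
  moreover have "saturated \<alpha> \<omega>" if "bij \<phi>"
    using saturated_if_inj bij_is_inj[OF that] assms by simp
  ultimately show ?thesis by blast
qed

end
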